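(* The measure $\nu'$ converges weakly to $\beta$ as $\Sigma\to\infty$. That is: for every continuous function $g:Y\to\mathbb{R}$ and every $\varepsilon>0$ there exists $R>0$ such that, for every sequence $(a_k)_{k\ge1}$ of pairwise relatively prime integers $a_k\ge2$ with $R<\Sigma=\sum_{k\ge1}\frac1{a_k}<\infty$, the associated measure $\nu'$ satisfies $\left|\int_Yg\,d\nu'-\int_Yg\,d\beta\right|<\varepsilon$.
   Context: $\mathbb{N}^*=\{1,2,3,\ldots\}$ and $Y=\{-1,1\}^{\mathbb{N}^*}$ with the product topology. $\beta$ is the Bernoulli measure on $Y$ under which the coordinates are independent and uniformly distributed on $\{-1,1\}$. Given a sequence $(a_k)_{k\ge1}$ of pairwise relatively prime integers $a_k\ge2$ with $\Sigma=\sum_{k\ge1}1/a_k<\infty$: let $\Omega'=\prod_{k\ge1}\mathbb{Z}/a_k\mathbb{Z}$ with normalized Haar measure $\mathbb{P}'$, and $T'(\omega'_k)_{k\ge1}=(\omega'_k+1)_{k\ge1}$. For $\omega'\in\Omega'$, $\Delta(\omega')=|\{k\ge1:\omega'_k=0\}|\in\{0,1,2,\ldots\}\cup\{\infty\}$, which is finite $\mathbb{P}'$-almost surely. The map $\psi:\Omega'\to Y$, $\psi(\omega')=\bigl((-1)^{\Delta(T'^n\omega')}\bigr)_{n\in\mathbb{N}^*}$, is defined $\mathbb{P}'$-almost surely, and $\nu'$ is the pushforward of $\mathbb{P}'$ by $\psi$. *)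

theory Defs
  imports "HOL-Probability.Probability" "HOL-Library.Extended_Nat"
begin

(* Sequences indexed by the positive integers are extensional functions on {1..}; a residue
   class modulo m is represented by its canonical representative in {0..<m}. *)

definition Y_topology :: "(nat \<Rightarrow> int) topology" where
  "Y_topology = product_topology (\<lambda>_. discrete_topology {-1, 1}) {1..}"

(* The product sigma-algebra; it is the Borel sigma-algebra of Y_topology, since the product is
   countable and its factors are finite discrete. *)
definition Y_space :: "(nat \<Rightarrow> int) measure" where
  "Y_space = (\<Pi>\<^sub>M n\<in>{1..}. count_space {-1, 1})"

definition bernoulli_measure :: "(nat \<Rightarrow> int) measure" where
  "bernoulli_measure = (\<Pi>\<^sub>M n\<in>{1..}. uniform_count_measure {-1, 1})"

definition admissible :: "(nat \<Rightarrow> nat) \<Rightarrow> bool" where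
  "admissible a \<longleftrightarrow>
     (\<forall>k\<ge>1. 2 \<le> a k) \<and>
     pairwise (\<lambda>j k. coprime (a j) (a k)) {1..} \<and>
     (\<lambda>k. 1 / real (a k)) summable_on {1..}"

definition Sigma_sum :: "(nat \<Rightarrow> nat) \<Rightarrow> real" where
  "Sigma_sum a = (\<Sum>\<^sub>\<infinity>k\<in>{1..}. 1 / real (a k))"

(* The normalized Haar measure of a product of finite groups is the product of the normalized
   counting measures; the lemmas Omega_measure_translate and prob_space_Omega_measure below
   confirm that it is a translation-invariant probability measure. *)
definition Omega_measure :: "(nat \<Rightarrow> nat) \<Rightarrow> (nat \<Rightarrow> nat) measure" where
  "Omega_measure a = (\<Pi>\<^sub>M k\<in>{1..}. uniform_count_measure {0..<a k})"

definition Omega_add :: "(nat \<Rightarrow> nat) \<Rightarrow> (nat \<Rightarrow> nat) \<Rightarrow> (nat \<Rightarrow> nat) \<Rightarrow> (nat \<Rightarrow> nat)" where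
  "Omega_add a w v = (\<lambda>k\<in>{1..}. (w k + v k) mod a k)"

definition rotation :: "(nat \<Rightarrow> nat) \<Rightarrow> (nat \<Rightarrow> nat) \<Rightarrow> (nat \<Rightarrow> nat)" where
  "rotation a w = (\<lambda>k\<in>{1..}. (w k + 1) mod a k)"

definition Delta :: "(nat \<Rightarrow> nat) \<Rightarrow> enat" where
  "Delta w = (if finite {k \<in> {1..}. w k = 0} then enat (card {k \<in> {1..}. w k = 0}) else \<infinity>)"

(* The value at \<infinity> is arbitrary: for admissible a, it is only used on a null set. *)
definition neg_one_power :: "enat \<Rightarrow> int" where
  "neg_one_power d = (case d of enat m \<Rightarrow> (-1) ^ m | \<infinity> \<Rightarrow> 1)"

definition psi :: "(nat \<Rightarrow> nat) \<Rightarrow> (nat \<Rightarrow> nat) \<Rightarrow> (nat \<Rightarrow> int)" where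
  "psi a w = (\<lambda>n\<in>{1..}. neg_one_power (Delta ((rotation a ^^ n) w)))"

definition nu :: "(nat \<Rightarrow> nat) \<Rightarrow> (nat \<Rightarrow> int) measure" where
  "nu a = distr (Omega_measure a) Y_space (psi a)"

lemma prob_space_uniform_residues:
  "0 < m \<Longrightarrow> prob_space (uniform_count_measure {0..<m::nat})"
  by (rule prob_space_uniform_count_measure) auto

lemma prob_space_Omega_measure:
  assumes "\<forall>k\<ge>1. 2 \<le> a k"
  shows "prob_space (Omega_measure a)"
  unfolding Omega_measure_def
  by (rule prob_space_PiM, rule prob_space_uniform_residues) (use assms in fastforce)

lemma bij_betw_add_mod:
  fixes m h :: nat
  assumes "0 < m"
  shows "bij_betw (\<lambda>x. (x + h) mod m) {0..<m} {0..<m}"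
proof -
  have inj: "inj_on (\<lambda>x. (x + h) mod m) {0..<m}"
  proof (rule inj_onI)
    fix x y assume xy: "x \<in> {0..<m}" "y \<in> {0..<m}" "(x + h) mod m = (y + h) mod m"
    then obtain p q where "(x + h) + m * p = (y + h) + m * q"
      using nat_mod_eq_iff[of "x + h" m "y + h"] by blast
    then have "x + m * p = y + m * q" by linarith
    then have "x mod m = y mod m" using nat_mod_eq_iff by blast
    then show "x = y" using xy by simp
  qed
  moreover have "(\<lambda>x. (x + h) mod m) ` {0..<m} = {0..<m}"
    by (rule endo_inj_surj[OF _ _ inj]) (use assms in auto)
  ultimately show ?thesis by (simp add: bij_betw_def)
qed

lemma add_mod_measurable:
  fixes m h :: nat
  assumes "0 < m"
  shows "(\<lambda>x. (x + h) mod m) \<in>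
    measurable (uniform_count_measure {0..<m}) (uniform_count_measure {0..<m})"
  using assms
  by (auto simp: measurable_def space_uniform_count_measure sets_uniform_count_measure)

lemma distr_uniform_residues:
  fixes m h :: nat
  assumes "0 < m"
  shows "distr (uniform_count_measure {0..<m}) (uniform_count_measure {0..<m})
           (\<lambda>x. (x + h) mod m) = uniform_count_measure {0..<m}"
proof (rule measure_eqI)
  let ?f = "\<lambda>x. (x + h) mod m" and ?U = "uniform_count_measure {0..<m}"
  have bij: "bij_betw ?f {0..<m} {0..<m}" by (rule bij_betw_add_mod[OF assms])
  have meas: "?f \<in> measurable ?U ?U"
    using assms by (rule add_mod_measurable)
  fix A assume "A \<in> sets (distr ?U ?U ?f)"
  then have A: "A \<subseteq> {0..<m}" by (auto simp: sets_uniform_count_measure)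
  have "bij_betw ?f (?f -` A \<inter> {0..<m}) A"
  proof (rule bij_betw_imageI)
    show "inj_on ?f (?f -` A \<inter> {0..<m})"
      using bij_betw_imp_inj_on[OF bij] by (rule inj_on_subset) simp
    show "?f ` (?f -` A \<inter> {0..<m}) = A"
    proof (intro equalityI subsetI)
      fix y assume "y \<in> A"
      with A have "y \<in> ?f ` {0..<m}" by (simp only: bij_betw_imp_surj_on[OF bij] subset_iff)
      then obtain x where "x \<in> {0..<m}" "y = ?f x" by (rule imageE)
      with \<open>y \<in> A\<close> show "y \<in> ?f ` (?f -` A \<inter> {0..<m})" by blast
    qed blast
  qed
  then have "card (?f -` A \<inter> {0..<m}) = card A" by (rule bij_betw_same_card)
  moreover have "emeasure (distr ?U ?U ?f) A = emeasure ?U (?f -` A \<inter> {0..<m})"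
    using emeasure_distr[OF meas, of A] A
    by (simp add: sets_uniform_count_measure space_uniform_count_measure)
  ultimately show "emeasure (distr ?U ?U ?f) A = emeasure ?U A"
    using emeasure_uniform_count_measure[of "{0..<m}"] A by simp
qed simp

lemma Omega_add_measurable:
  assumes "\<forall>k\<ge>1. 2 \<le> a k"
  shows "(\<lambda>w. Omega_add a w v) \<in> measurable (Omega_measure a) (Omega_measure a)"
  unfolding Omega_measure_def Omega_add_def
proof (rule measurable_restrict)
  fix k :: nat assume k: "k \<in> {1..}"
  then have "0 < a k" using assms by fastforce
  then have "(\<lambda>x. (x + v k) mod a k) \<in>
      measurable (uniform_count_measure {0..<a k}) (uniform_count_measure {0..<a k})"
    by (rule add_mod_measurable)
  with k show "(\<lambda>w. (w k + v k) mod a k) \<in>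
      measurable (\<Pi>\<^sub>M k\<in>{1..}. uniform_count_measure {0..<a k}) (uniform_count_measure {0..<a k})"
    by (rule measurable_PiM_component_rev)
qed

lemma Omega_measure_translate:
  assumes a: "\<forall>k\<ge>1. 2 \<le> a k"
  shows "distr (Omega_measure a) (Omega_measure a) (\<lambda>w. Omega_add a w v) = Omega_measure a"
proof -
  let ?M = "\<lambda>k. uniform_count_measure {0..<a k}"
  let ?P = "PiM {1..} ?M" and ?t = "\<lambda>w. Omega_add a w v"
  have pos: "0 < a k" if "k \<in> {1..}" for k using a that by fastforce
  have prob: "prob_space (?M k)" if "k \<in> {1..}" for k
    using pos[OF that] by (rule prob_space_uniform_residues)
  have meas: "?t \<in> measurable ?P ?P"
    using Omega_add_measurable[OF a] by (simp add: Omega_measure_def)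
  have "distr ?P ?P ?t = ?P"
  proof (rule measure_eqI_PiM_infinite[symmetric, OF refl])
    interpret prob_space ?P by (rule prob_space_PiM) (rule prob)
    show "finite_measure ?P" by unfold_locales
    fix A and J :: "nat set"
    assume J: "finite J" "J \<subseteq> {1..}" and A: "\<And>k. k \<in> J \<Longrightarrow> A k \<in> sets (?M k)"
    let ?B = "\<lambda>k. (\<lambda>x. (x + v k) mod a k) -` A k \<inter> {0..<a k}"
    have B: "emeasure (?M k) (?B k) = emeasure (?M k) (A k)" if "k \<in> J" for k
    proof -
      have k: "0 < a k" using pos J that by auto
      have meas': "(\<lambda>x. (x + v k) mod a k) \<in> measurable (?M k) (?M k)"
        using k by (rule add_mod_measurable)
      have "emeasure (?M k) (A k)
          = emeasure (distr (?M k) (?M k) (\<lambda>x. (x + v k) mod a k)) (A k)"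
        by (simp add: distr_uniform_residues[OF k])
      also have "\<dots> = emeasure (?M k) (?B k)"
        using emeasure_distr[OF meas' A[OF that]] by (simp add: space_uniform_count_measure)
      finally show ?thesis by simp
    qed
    have "?t -` prod_emb {1..} ?M J (Pi\<^sub>E J A) \<inter> space ?P = prod_emb {1..} ?M J (Pi\<^sub>E J ?B)"
    proof (rule set_eqI)
      fix w
      show "w \<in> ?t -` prod_emb {1..} ?M J (Pi\<^sub>E J A) \<inter> space ?P
          \<longleftrightarrow> w \<in> prod_emb {1..} ?M J (Pi\<^sub>E J ?B)"
      proof (cases "w \<in> space ?P")
        case True
        then have w: "w k \<in> {0..<a k}" if "k \<in> {1..}" for k
          using that by (auto simp: space_PiM PiE_iff space_uniform_count_measure)
        have "?t w \<in> space ?P" using True meas by (rule measurable_space[rotated])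
        then have "w \<in> ?t -` prod_emb {1..} ?M J (Pi\<^sub>E J A) \<inter> space ?P
            \<longleftrightarrow> (\<forall>k\<in>J. ?t w k \<in> A k)"
          using True by (simp add: prod_emb_def space_PiM PiE_iff)
        also have "\<dots> \<longleftrightarrow> (\<forall>k\<in>J. w k \<in> ?B k)"
        proof (rule ball_cong[OF refl])
          fix k assume "k \<in> J"
          with J(2) have "k \<in> {1..}" by (rule subsetD)
          then show "?t w k \<in> A k \<longleftrightarrow> w k \<in> ?B k" using w[of k] by (simp add: Omega_add_def)
        qed
        also have "\<dots> \<longleftrightarrow> w \<in> prod_emb {1..} ?M J (Pi\<^sub>E J ?B)"
          using True by (simp add: prod_emb_def space_PiM PiE_iff)
        finally show ?thesis .
      next
        case False
        then show ?thesis by (simp add: prod_emb_def space_PiM)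
      qed
    qed
    then have "emeasure (distr ?P ?P ?t) (prod_emb {1..} ?M J (Pi\<^sub>E J A))
        = emeasure ?P (prod_emb {1..} ?M J (Pi\<^sub>E J ?B))"
      using emeasure_distr[OF meas sets_PiM_I[OF J ballI[OF A]]] by simp
    also have "\<dots> = (\<Prod>k\<in>J. emeasure (?M k) (?B k))"
      using J by (intro emeasure_PiM_emb prob) (auto simp: sets_uniform_count_measure)
    also have "\<dots> = (\<Prod>k\<in>J. emeasure (?M k) (A k))"
      by (intro prod.cong refl B)
    also have "\<dots> = emeasure ?P (prod_emb {1..} ?M J (Pi\<^sub>E J A))"
      using J A by (intro emeasure_PiM_emb[symmetric] prob) auto
    finally show "emeasure ?P (prod_emb {1..} ?M J (Pi\<^sub>E J A))
        = emeasure (distr ?P ?P ?t) (prod_emb {1..} ?M J (Pi\<^sub>E J A))" by simp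
  qed simp
  then show ?thesis unfolding Omega_measure_def .
qed

lemma rotation_measurable:
  assumes "\<forall>k\<ge>1. 2 \<le> a k"
  shows "rotation a \<in> measurable (Omega_measure a) (Omega_measure a)"
proof -
  have "rotation a = (\<lambda>w. Omega_add a w (\<lambda>_. 1))"
    by (rule ext) (simp only: rotation_def Omega_add_def)
  then show ?thesis by (simp only: Omega_add_measurable[OF assms])
qed

lemma Delta_measurable: "Delta \<in> measurable (Omega_measure a) (count_space UNIV)"
proof -
  let ?Z = "\<lambda>w. {k \<in> {1..}. w k = (0::nat)}"
  have Z: "{w \<in> space (Omega_measure a). k \<in> ?Z w} \<in> sets (Omega_measure a)" for k
  proof (cases "k \<in> {1..}")
    case True
    have "(\<lambda>x::nat. x = 0) \<in> measurable (uniform_count_measure {0..<a k}) (count_space UNIV)"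
      by (auto simp: measurable_def sets_uniform_count_measure space_uniform_count_measure)
    with True have "(\<lambda>w. w k = 0) \<in> measurable (Omega_measure a) (count_space UNIV)"
      unfolding Omega_measure_def by (rule measurable_PiM_component_rev)
    then have "{w \<in> space (Omega_measure a). w k = 0} \<in> sets (Omega_measure a)"
      by (simp add: pred_def)
    with True show ?thesis by simp
  qed simp
  have card: "(\<lambda>w. card (?Z w)) \<in> measurable (Omega_measure a) (count_space UNIV)"
    by (rule measurable_card) (rule Z)
  have fin: "{w \<in> space (Omega_measure a). finite (?Z w)} \<in> sets (Omega_measure a)"
    using measurable_finite[where S = ?Z, OF Z] unfolding pred_def .
  have enat: "(\<lambda>w. enat (card (?Z w))) \<in> measurable (Omega_measure a) (count_space UNIV)"
    using card by (rule measurable_compose) simp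
  show ?thesis
    unfolding Delta_def by (rule measurable_If[OF enat _ fin]) simp
qed

(* Without measurability, distr in the definition of nu would not be the pushforward. *)
lemma psi_measurable:
  assumes a: "\<forall>k\<ge>1. 2 \<le> a k"
  shows "psi a \<in> measurable (Omega_measure a) Y_space"
  unfolding psi_def Y_space_def
proof (rule measurable_restrict)
  fix n :: nat
  have "rotation a ^^ n \<in> measurable (Omega_measure a) (Omega_measure a)"
  proof (induction n)
    case (Suc n)
    then show ?case using measurable_comp[OF Suc.IH rotation_measurable[OF a]]
      by (simp add: comp_def)
  qed (simp add: id_def)
  then have "(\<lambda>w. Delta ((rotation a ^^ n) w)) \<in> measurable (Omega_measure a) (count_space UNIV)"
    using Delta_measurable by (rule measurable_compose)
  moreover have "neg_one_power \<in> measurable (count_space UNIV) (count_space {-1, 1})"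
    using minus_one_power_iff by (auto simp: neg_one_power_def minus_one_power_iff split: enat.split)
  ultimately show "(\<lambda>w. neg_one_power (Delta ((rotation a ^^ n) w)))
      \<in> measurable (Omega_measure a) (count_space {-1, 1})"
    by (rule measurable_compose)
qed

end

theory Submission
  imports Defs
begin

text \<open>By compactness a continuous function on \<open>Y\<close> is uniformly close to a linear combination of
  Walsh functions \<open>y \<mapsto> \<Prod>n\<in>S. y n\<close> with \<open>S \<subseteq> {1..N}\<close>. For \<open>S \<noteq> {}\<close> such a function has mean \<open>0\<close>
  under the Bernoulli measure. Under the other measure independence of the residues turns its mean
  into the infinite product over \<open>k\<close> of the mean of \<open>\<Prod>n\<in>S. (-1)^[x + n \<equiv> 0 mod a k]\<close> over residues
  \<open>x\<close>, which is \<open>1 - 2 * card S / a k\<close> as soon as \<open>a k > N\<close>. Hence this mean is at most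
  \<open>exp (- 2 * (\<Sigma> - 2 * N))\<close> in absolute value and vanishes in the limit.\<close>

section \<open>Cylinders, uniform continuity and Walsh approximation on the sequence space\<close>

definition walsh :: "nat set \<Rightarrow> (nat \<Rightarrow> int) \<Rightarrow> real" where
  "walsh S y = (\<Prod>n\<in>S. real_of_int (y n))"

lemma topspace_Y_topology: "topspace Y_topology = {1..} \<rightarrow>\<^sub>E {-1, 1}"
  by (simp add: Y_topology_def)

lemma space_Y_space: "space Y_space = {1..} \<rightarrow>\<^sub>E {-1, 1}"
  by (simp add: Y_space_def space_PiM)

lemma Y_coordinate:
  "y \<in> {1..} \<rightarrow>\<^sub>E {-1, 1 :: int} \<Longrightarrow> 1 \<le> n \<Longrightarrow> y n = -1 \<or> y n = 1"
  by (auto simp: PiE_iff)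

text \<open>A basic open box around \<open>y\<close> inside the preimage of a ball constrains only
  finitely many coordinates, so \<open>N\<close> can be any bound for these.\<close>

lemma Y_local_cylinder:
  assumes g: "continuous_map Y_topology euclideanreal g" and "0 < e" and y: "y \<in> topspace Y_topology"
  shows "\<exists>N. \<forall>z\<in>topspace Y_topology. (\<forall>n\<in>{1..N}. z n = y n) \<longrightarrow> \<bar>g z - g y\<bar> < e"
proof -
  let ?W = "{z \<in> topspace Y_topology. g z \<in> ball (g y) e}"
  have "openin Y_topology ?W"
    using g by (rule openin_continuous_map_preimage) simp
  moreover have "y \<in> ?W"
    using y \<open>0 < e\<close> by simp
  ultimately have "\<exists>U. finite {n \<in> {1..}. U n \<noteq> topspace (discrete_topology {-1, 1 :: int})} \<and>
      (\<forall>n\<in>{1..}. openin (discrete_topology {-1, 1}) (U n)) \<and> y \<in> Pi\<^sub>E {1..} U \<and> Pi\<^sub>E {1..} U \<subseteq> ?W"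
    unfolding Y_topology_def openin_product_topology_alt by (rule bspec)
  then obtain U where fin: "finite {n \<in> {1..}. U n \<noteq> topspace (discrete_topology {-1, 1 :: int})}"
    and yU: "y \<in> Pi\<^sub>E {1..} U" and UW: "Pi\<^sub>E {1..} U \<subseteq> ?W"
    by blast
  obtain N where N: "{n \<in> {1..}. U n \<noteq> {-1, 1}} \<subseteq> {..N}"
    using fin finite_nat_iff_bounded_le by auto
  have "\<bar>g z - g y\<bar> < e" if z: "z \<in> topspace Y_topology" "\<forall>n\<in>{1..N}. z n = y n" for z
  proof -
    have "z n \<in> U n" if "1 \<le> n" for n
    proof (cases "n \<le> N")
      case True
      then show ?thesis using z(2) yU that by (auto simp: PiE_iff)
    next
      case False
      then have "U n = {-1, 1}" using subsetD[OF N, of n] that by fastforce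
      then show ?thesis using z(1) that by (auto simp: topspace_Y_topology PiE_iff)
    qed
    then have "z \<in> Pi\<^sub>E {1..} U"
      using z(1) by (auto simp: topspace_Y_topology PiE_iff)
    then show ?thesis using UW by (auto simp: dist_real_def)
  qed
  then show ?thesis by blast
qed

text \<open>The cylinder is a box whose factors are singletons up to \<open>N\<close>, open because
  the factors are discrete, and the full two-point set beyond.\<close>

lemma openin_Y_cylinder:
  assumes "y \<in> topspace Y_topology"
  shows "openin Y_topology {z \<in> topspace Y_topology. \<forall>n\<in>{1..N}. z n = y n}"
proof -
  let ?U = "\<lambda>n. if n \<le> N then {y n} else {-1, 1}"
  have "{z \<in> topspace Y_topology. \<forall>n\<in>{1..N}. z n = y n} = Pi\<^sub>E {1..} ?U"
  proof (rule set_eqI)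
    fix z
    have "z n \<in> ?U n \<longleftrightarrow> z n \<in> {-1, 1} \<and> (n \<le> N \<longrightarrow> z n = y n)" if "n \<in> {1..}" for n
      using Y_coordinate[of y n] assms that by (auto simp: topspace_Y_topology)
    then have "(\<forall>n\<in>{1..}. z n \<in> ?U n)
        \<longleftrightarrow> (\<forall>n\<in>{1..}. z n \<in> {-1, 1}) \<and> (\<forall>n\<in>{1..N}. z n = y n)"
      by auto
    then show "z \<in> {z \<in> topspace Y_topology. \<forall>n\<in>{1..N}. z n = y n} \<longleftrightarrow> z \<in> Pi\<^sub>E {1..} ?U"
      unfolding topspace_Y_topology PiE_iff by blast
  qed
  moreover have "finite {n. ?U n \<noteq> {-1, 1}}"
    by (rule finite_subset[of _ "{..N}"]) auto
  ultimately show ?thesis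
    using assms unfolding Y_topology_def
    by (auto simp: openin_PiE_gen PiE_iff elim: finite_subset[rotated])
qed

text \<open>Compactness extracts finitely many cylinders from those of the previous lemmas, taken
  for \<open>e / 2\<close>. Agreement up to the greatest of their lengths puts both points into one
  cylinder, and its centre links them by the triangle inequality.\<close>

lemma Y_uniformly_continuous:
  assumes g: "continuous_map Y_topology euclideanreal g" and "0 < e"
  shows "\<exists>N. \<forall>y\<in>topspace Y_topology. \<forall>z\<in>topspace Y_topology.
           (\<forall>n\<in>{1..N}. y n = z n) \<longrightarrow> \<bar>g y - g z\<bar> < e"
proof -
  let ?Y = "topspace Y_topology"
  have "\<forall>y\<in>?Y. \<exists>N. \<forall>z\<in>?Y. (\<forall>n\<in>{1..N}. z n = y n) \<longrightarrow> \<bar>g z - g y\<bar> < e / 2"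
    using Y_local_cylinder[OF g half_gt_zero[OF \<open>0 < e\<close>]] by blast
  then obtain N where N: "\<And>y z. y \<in> ?Y \<Longrightarrow> z \<in> ?Y \<Longrightarrow> (\<forall>n\<in>{1..N y}. z n = y n) \<Longrightarrow> \<bar>g z - g y\<bar> < e / 2"
    by metis
  define C where "C y = {z \<in> ?Y. \<forall>n\<in>{1..N y}. z n = y n}" for y
  have "compact_space Y_topology"
    by (simp add: Y_topology_def compact_space_product_topology compact_space_discrete_topology)
  moreover have "\<forall>U\<in>C ` ?Y. openin Y_topology U"
    unfolding C_def using openin_Y_cylinder by blast
  moreover have "?Y \<subseteq> \<Union>(C ` ?Y)"
    by (auto simp: C_def)
  ultimately obtain \<F> where "finite \<F>" "\<F> \<subseteq> C ` ?Y" and cover: "?Y \<subseteq> \<Union>\<F>"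
    unfolding compact_space_alt by meson
  then obtain F where F: "F \<subseteq> ?Y" "finite F" "\<F> = C ` F"
    by (meson finite_subset_image)
  \<comment> \<open>The inserted 0 keeps the maximum well defined when \<open>F\<close> is
    empty.\<close>
  define K where "K = Max (insert 0 (N ` F))"
  have K: "N x \<le> K" if "x \<in> F" for x
    unfolding K_def using F(2) that by (intro Max_ge) auto
  have "\<bar>g y - g z\<bar> < e" if yz: "y \<in> ?Y" "z \<in> ?Y" "\<forall>n\<in>{1..K}. y n = z n" for y z
  proof -
    obtain x where x: "x \<in> F" "y \<in> C x"
      using cover yz(1) F(3) by auto
    then have "\<forall>n\<in>{1..N x}. y n = x n" "\<forall>n\<in>{1..N x}. z n = x n"
      using yz(3) K[OF x(1)] by (auto simp: C_def)
    then have "\<bar>g y - g x\<bar> < e / 2" "\<bar>g z - g x\<bar> < e / 2"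
      using N x(1) F(1) yz by blast+
    then show ?thesis by linarith
  qed
  then show ?thesis by blast
qed

text \<open>On the first \<open>N\<close> coordinates, the indicator function of a sign pattern \<open>z\<close> is
  \<open>\<Prod>n (1 + y n * z n) / 2\<close>; expanding the product gives a combination of Walsh functions.\<close>

lemma indicator_eq_sum_walsh:
  assumes "\<And>n. n \<in> A \<Longrightarrow> y n = -1 \<or> y n = 1" "\<And>n. n \<in> A \<Longrightarrow> z n = -1 \<or> z n = 1" and "finite A"
  shows "(if \<forall>n\<in>A. y n = z n then 1 else 0) = (\<Sum>S\<in>Pow A. walsh S z / 2 ^ card A * walsh S y)"
proof -
  have "(if \<forall>n\<in>A. y n = z n then 1 else 0)
      = (\<Prod>n\<in>A. (real_of_int (y n) * real_of_int (z n) + 1) / 2)"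
  proof (cases "\<forall>n\<in>A. y n = z n")
    case True
    have "(real_of_int (y n) * real_of_int (z n) + 1) / 2 = 1" if "n \<in> A" for n
      using assms(1)[OF that] True that by auto
    then show ?thesis using True by simp
  next
    case False
    then obtain n where n: "n \<in> A" "y n \<noteq> z n" by blast
    \<comment> \<open>Opposite signs have product -1, so this single factor kills the whole
      product.\<close>
    then have "real_of_int (y n) * real_of_int (z n) + 1 = 0"
      using assms(1,2)[OF n(1)] by auto
    then have "(\<Prod>n\<in>A. (real_of_int (y n) * real_of_int (z n) + 1) / 2) = 0"
      using n(1) \<open>finite A\<close> by (intro prod_zero) auto
    then show ?thesis using False by simp
  qed
  also have "\<dots> = (\<Prod>n\<in>A. real_of_int (y n) * real_of_int (z n) + 1) / 2 ^ card A"
    by (simp add: prod_dividef)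
  also have "\<dots> = (\<Sum>S\<in>Pow A. walsh S z / 2 ^ card A * walsh S y)"
    by (simp add: prod_add[OF \<open>finite A\<close>] walsh_def prod.distrib sum_divide_distrib mult.commute)
  finally show ?thesis .
qed

text \<open>Setting all coordinates beyond \<open>N\<close> to 1 changes \<open>g\<close> by less
  than \<open>e\<close>. The resulting function depends on a finite sign pattern, so it is a sum of
  values times pattern indicators, each of which is a Walsh combination.\<close>

lemma walsh_approximation:
  assumes g: "continuous_map Y_topology euclideanreal g" and "0 < e"
  obtains N c where "\<And>y. y \<in> topspace Y_topology \<Longrightarrow>
    \<bar>g y - (\<Sum>S\<in>Pow {1..N}. c S * walsh S y)\<bar> < e"
proof -
  obtain N where N: "\<And>y z. y \<in> topspace Y_topology \<Longrightarrow> z \<in> topspace Y_topology \<Longrightarrow>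
      (\<forall>n\<in>{1..N}. y n = z n) \<Longrightarrow> \<bar>g y - g z\<bar> < e"
    using Y_uniformly_continuous[OF assms] by blast
  let ?A = "{1..N}"
  let ?Z = "?A \<rightarrow>\<^sub>E {-1, 1 :: int}"
  \<comment> \<open>Completes a finite pattern to a point of the space at which \<open>g\<close> can
    be evaluated.\<close>
  define ext where "ext z = (\<lambda>n\<in>{1..}. if n \<le> N then z n else 1)" for z :: "nat \<Rightarrow> int"
  \<comment> \<open>The coefficient of \<open>walsh S\<close> collected from the indicators of all
    patterns \<open>z\<close>, weighted by the values of \<open>g\<close>.\<close>
  define c where "c S = (\<Sum>z\<in>?Z. g (ext z) * (walsh S z / 2 ^ card ?A))" for S
  show thesis
  proof (rule that[of c N])
    fix y assume y: "y \<in> topspace Y_topology"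
    let ?r = "restrict y ?A"
    have r: "?r \<in> ?Z" and ext_r: "ext ?r \<in> topspace Y_topology"
      using y by (auto simp: topspace_Y_topology ext_def PiE_iff)
    have "(\<Sum>S\<in>Pow ?A. c S * walsh S y)
        = (\<Sum>z\<in>?Z. g (ext z) * (\<Sum>S\<in>Pow ?A. walsh S z / 2 ^ card ?A * walsh S y))"
      unfolding c_def sum_distrib_right sum_distrib_left
      by (subst sum.swap) (simp add: mult.assoc)
    also have "\<dots> = (\<Sum>z\<in>?Z. g (ext z) * (if \<forall>n\<in>?A. y n = z n then 1 else 0))"
      using y by (intro sum.cong refl arg_cong2[where f = "(*)"] indicator_eq_sum_walsh[symmetric])
        (auto simp: topspace_Y_topology PiE_iff)
    \<comment> \<open>Extensionality makes the restriction of \<open>y\<close> the only pattern in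
      \<open>?Z\<close> that agrees with \<open>y\<close>.\<close>
    also have "\<dots> = (\<Sum>z\<in>?Z. if z = ?r then g (ext z) else 0)"
    proof (intro sum.cong refl)
      fix z assume "z \<in> ?Z"
      then have "(\<forall>n\<in>?A. y n = z n) \<longleftrightarrow> z = ?r"
        by (auto simp: PiE_iff extensional_def fun_eq_iff)
      then show "g (ext z) * (if \<forall>n\<in>?A. y n = z n then 1 else 0) = (if z = ?r then g (ext z) else 0)"
        by simp
    qed
    also have "\<dots> = g (ext ?r)"
      using r by (simp add: finite_PiE)
    finally show "\<bar>g y - (\<Sum>S\<in>Pow ?A. c S * walsh S y)\<bar> < e"
      using N[OF y ext_r] by (simp add: ext_def)
  qed
qed

section \<open>Measurability and the two probability measures on \<open>Y_space\<close>\<close>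

lemma walsh_measurable: "S \<subseteq> {1..} \<Longrightarrow> walsh S \<in> borel_measurable Y_space"
  unfolding walsh_def Y_space_def
  by (intro borel_measurable_prod measurable_PiM_component_rev[where f = real_of_int]) auto

lemma abs_walsh:
  assumes "y \<in> space Y_space" "S \<subseteq> {1..}"
  shows "\<bar>walsh S y\<bar> = 1"
proof -
  have "\<bar>real_of_int (y n)\<bar> = 1" if "n \<in> S" for n
    using Y_coordinate[of y n] assms that by (force simp: space_Y_space)
  then show ?thesis by (simp add: walsh_def abs_prod)
qed

text \<open>Connects the topology with the product sigma-algebra: by approximation with errors
  \<open>1 / real (Suc i)\<close>, \<open>g\<close> is a pointwise limit of Walsh combinations,
  which are measurable.\<close>

lemma continuous_Y_measurable:
  assumes g: "continuous_map Y_topology euclideanreal g"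
  shows "g \<in> borel_measurable Y_space"
proof -
  have "\<exists>p. p \<in> borel_measurable Y_space \<and> (\<forall>y\<in>space Y_space. \<bar>g y - p y\<bar> < 1 / real (Suc i))" for i
  proof -
    obtain N c where "\<And>y. y \<in> topspace Y_topology \<Longrightarrow>
        \<bar>g y - (\<Sum>S\<in>Pow {1..N}. c S * walsh S y)\<bar> < 1 / real (Suc i)"
      by (rule walsh_approximation[OF g, of "1 / real (Suc i)"]) auto
    moreover have "(\<lambda>y. \<Sum>S\<in>Pow {1..N}. c S * walsh S y) \<in> borel_measurable Y_space"
      by (intro borel_measurable_sum borel_measurable_times borel_measurable_const walsh_measurable)
        auto
    ultimately show ?thesis by (auto simp: topspace_Y_topology space_Y_space)
  qed
  then obtain p where p: "\<And>i. p i \<in> borel_measurable Y_space"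
    "\<And>i y. y \<in> space Y_space \<Longrightarrow> \<bar>g y - p i y\<bar> < 1 / real (Suc i)"
    by metis
  show ?thesis
  proof (rule borel_measurable_LIMSEQ_real[OF _ p(1)])
    fix y assume y: "y \<in> space Y_space"
    show "(\<lambda>i. p i y) \<longlonglongrightarrow> g y"
    proof (rule LIMSEQ_I)
      fix r :: real assume "0 < r"
      then obtain n where n: "1 / real (Suc n) < r"
        using reals_Archimedean by (auto simp: inverse_eq_divide)
      have "norm (p i y - g y) < r" if "n \<le> i" for i
      proof -
        have "1 / real (Suc i) \<le> 1 / real (Suc n)" using that by (simp add: field_simps)
        then show ?thesis using p(2)[OF y, of i] n by simp
      qed
      then show "\<exists>n. \<forall>i\<ge>n. norm (p i y - g y) < r" by blast
    qed
  qed
qed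

lemma sets_bernoulli_measure: "sets bernoulli_measure = sets Y_space"
  unfolding bernoulli_measure_def Y_space_def
  by (rule sets_PiM_cong) (simp_all add: sets_uniform_count_measure)

lemma prob_space_bernoulli_measure: "prob_space bernoulli_measure"
  unfolding bernoulli_measure_def
  by (intro prob_space_PiM prob_space_uniform_count_measure) auto

lemma prob_space_nu:
  assumes "admissible a"
  shows "prob_space (nu a)"
proof -
  interpret prob_space "Omega_measure a"
    using assms by (intro prob_space_Omega_measure) (simp add: admissible_def)
  show ?thesis
    unfolding nu_def using assms by (intro prob_space_distr psi_measurable) (simp add: admissible_def)
qed

lemma sets_nu: "sets (nu a) = sets Y_space"
  by (simp add: nu_def)

section \<open>Expectations of products of independent coordinates\<close>

text \<open>The integrand sees only the coordinates in \<open>J\<close>, so the integral can be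
  pushed forward to the finite subproduct, where Fubini factors it.\<close>

lemma integral_PiM_finite_prod:
  fixes f :: "'i \<Rightarrow> 'a \<Rightarrow> real"
  assumes M: "\<And>i. i \<in> I \<Longrightarrow> prob_space (M i)" and J: "finite J" "J \<subseteq> I"
    and f: "\<And>i. i \<in> J \<Longrightarrow> integrable (M i) (f i)"
  shows "(\<integral>w. (\<Prod>i\<in>J. f i (w i)) \<partial>PiM I M) = (\<Prod>i\<in>J. integral\<^sup>L (M i) (f i))"
proof -
  \<comment> \<open>Point masses outside \<open>I\<close> make every index carry a probability
    measure, as \<open>product_prob_space\<close> demands.\<close>
  define M' where "M' i = (if i \<in> I then M i else return (count_space UNIV) undefined)" for i
  have M': "prob_space (M' i)" for i
    using M by (auto simp: M'_def intro: prob_space_return)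
  interpret product_prob_space M' I
    by (simp add: product_prob_space_def product_prob_space_axioms_def product_sigma_finite_def M'
        prob_space_imp_sigma_finite)
  have meas: "(\<lambda>w. \<Prod>i\<in>J. f i (w i)) \<in> borel_measurable (PiM J M')"
    by (intro borel_measurable_prod measurable_PiM_component_rev)
      (use f J in \<open>auto simp: M'_def\<close>)
  have "(\<integral>w. (\<Prod>i\<in>J. f i (w i)) \<partial>PiM I M) = (\<integral>w. (\<Prod>i\<in>J. f i (restrict w J i)) \<partial>PiM I M')"
    by (intro Bochner_Integration.integral_cong PiM_cong prod.cong) (auto simp: M'_def)
  also have "\<dots> = (\<integral>w. (\<Prod>i\<in>J. f i (w i)) \<partial>distr (PiM I M') (PiM J M') (\<lambda>w. restrict w J))"
    by (rule integral_distr[symmetric, OF measurable_restrict_subset[OF J(2)] meas])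
  also have "\<dots> = (\<integral>w. (\<Prod>i\<in>J. f i (w i)) \<partial>PiM J M')"
    by (simp only: distr_PiM_restrict_finite[OF J])
  also have "\<dots> = (\<Prod>i\<in>J. integral\<^sup>L (M' i) (f i))"
    using f J by (intro product_integral_prod) (auto simp: M'_def)
  also have "\<dots> = (\<Prod>i\<in>J. integral\<^sup>L (M i) (f i))"
    using J by (intro prod.cong) (auto simp: M'_def)
  finally show ?thesis .
qed

lemma integrable_uniform_count_measure:
  fixes f :: "'a \<Rightarrow> real"
  assumes "finite A"
  shows "integrable (uniform_count_measure A) f"
  using assms by (simp add: uniform_count_measure_def integrable_point_measure_finite)

text \<open>The integral factors into means of a fair sign, each zero; \<open>S\<close> being
  nonempty provides at least one such factor.\<close>

lemma integral_walsh_bernoulli: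
  assumes "finite S" "S \<subseteq> {1..}" "S \<noteq> {}"
  shows "(\<integral>y. walsh S y \<partial>bernoulli_measure) = 0"
proof -
  have "(\<integral>y. walsh S y \<partial>bernoulli_measure)
      = (\<Prod>n\<in>S. \<integral>x. real_of_int x \<partial>uniform_count_measure {-1, 1})"
    unfolding walsh_def bernoulli_measure_def using assms(1,2)
    by (intro integral_PiM_finite_prod prob_space_uniform_count_measure integrable_uniform_count_measure)
      auto
  also have "\<dots> = 0"
    using assms by (simp add: integral_uniform_count_measure card_gt_0_iff)
  finally show ?thesis .
qed


section \<open>The Walsh mean of a single residue\<close>

text \<open>The contribution of one modulus \<open>m\<close> to the mean of \<open>walsh S\<close>
  under \<open>nu a\<close>: a uniform residue \<open>x\<close> flips the sign at each time
  \<open>n\<close> when its orbit meets 0.\<close>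

definition walsh_factor :: "nat set \<Rightarrow> nat \<Rightarrow> real" where
  "walsh_factor S m = (\<Sum>x = 0..<m. \<Prod>n\<in>S. if (x + n) mod m = 0 then -1 else 1) / real m"

lemma abs_walsh_factor_le: "\<bar>walsh_factor S m\<bar> \<le> 1"
proof -
  have "\<bar>\<Sum>x = 0..<m. \<Prod>n\<in>S. if (x + n) mod m = 0 then -1 else 1 :: real\<bar>
      \<le> (\<Sum>x = 0..<m. \<bar>\<Prod>n\<in>S. if (x + n) mod m = 0 then -1 else 1\<bar>)"
    by (rule sum_abs)
  also have "\<dots> = (\<Sum>x = 0..<m. 1)"
    by (intro sum.cong refl) (auto simp: abs_prod intro!: prod.neutral)
  finally show ?thesis
    by (simp add: walsh_factor_def divide_le_eq)
qed

text \<open>As \<open>S\<close> lies within one period, each residue meets 0 at most once during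
  \<open>S\<close>. Exactly \<open>card S\<close> residues do so, namely the \<open>m - n\<close>
  with \<open>n\<close> in \<open>S\<close>, and these count -1 instead of 1.\<close>

lemma walsh_factor_eq:
  assumes S: "S \<subseteq> {1..N}" and "N < m"
  shows "walsh_factor S m = 1 - 2 * real (card S) / real m"
proof -
  have "(\<Prod>n\<in>S. if (x + n) mod m = 0 then -1 else 1) = (if m - x \<in> S then -1 else 1 :: real)"
    if "x < m" for x
  proof -
    have "(x + n) mod m = 0 \<longleftrightarrow> n = m - x" if "n \<in> S" for n
    proof
      assume "(x + n) mod m = 0"
      \<comment> \<open>The only multiple of \<open>m\<close> strictly between 0 and
        \<open>2 * m\<close> is \<open>m\<close> itself; positivity uses that times start at
        1.\<close>
      moreover have "0 < x + n" "x + n < 2 * m" using that S \<open>x < m\<close> \<open>N < m\<close> by auto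
      ultimately have "x + n = m"
        by (metis mod_less mod_if le_add_diff_inverse2 less_diff_conv2 mult_2 neq0_conv not_less add.left_neutral)
      then show "n = m - x" by simp
    qed (use \<open>x < m\<close> in simp)
    then have "(\<Prod>n\<in>S. if (x + n) mod m = 0 then -1 else 1 :: real) = (\<Prod>n\<in>S. if n = m - x then -1 else 1)"
      by (intro prod.cong) auto
    also have "\<dots> = (if m - x \<in> S then -1 else 1)"
      using finite_subset[OF S] by (simp add: prod.delta)
    finally show ?thesis .
  qed
  then have "(\<Sum>x = 0..<m. \<Prod>n\<in>S. if (x + n) mod m = 0 then -1 else 1)
      = (\<Sum>x = 0..<m. if m - x \<in> S then -1 else 1 :: real)"
    by (intro sum.cong) auto
  also have "\<dots> = (\<Sum>j = 1..m. if j \<in> S then -1 else 1)"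
    by (rule sum.reindex_bij_witness[of _ "\<lambda>j. m - j" "\<lambda>x. m - x"]) auto
  also have "\<dots> = (\<Sum>j = 1..m. 1 - 2 * (if j \<in> S then 1 else 0))"
    by (intro sum.cong) auto
  also have "\<dots> = real m - 2 * real (card ({1..m} \<inter> S))"
    by (simp add: sum_subtractf flip: sum_distrib_left sum.inter_restrict)
  also have "{1..m} \<inter> S = S"
    using S \<open>N < m\<close> by auto
  finally show ?thesis
    using \<open>N < m\<close> by (simp add: walsh_factor_def diff_divide_distrib)
qed

lemma abs_walsh_factor_le_exp:
  assumes S: "S \<subseteq> {1..N}" "S \<noteq> {}" and "2 * N \<le> m"
  shows "\<bar>walsh_factor S m\<bar> \<le> exp (- 2 / real m)"
proof -
  have fin: "finite S" using S(1) by (rule finite_subset) simp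
  have "1 \<le> card S" "card S \<le> N"
    using S fin card_mono[OF _ S(1)] by (auto simp: Suc_le_eq card_gt_0_iff)
  moreover from this have "N < m" "real (card S) \<le> real N" "2 * real N \<le> real m"
    using assms(3) by linarith+
  ultimately have "2 * real (card S) / real m \<le> 1" "2 / real m \<le> 2 * real (card S) / real m"
    by (auto simp: field_simps)
  then have "\<bar>walsh_factor S m\<bar> \<le> 1 + (- 2 / real m)"
    unfolding walsh_factor_eq[OF S(1) \<open>N < m\<close>] by simp
  also have "\<dots> \<le> exp (- 2 / real m)"
    by (rule exp_ge_add_one_self)
  finally show ?thesis .
qed

section \<open>Hits of zero along the orbit and the infinite product for \<open>nu a\<close>\<close>

text \<open>With \<open>1 \<le> n\<close> at least one reduction takes place; for
  \<open>n = 0\<close> the left side would be the bare \<open>w k\<close>, possibly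
  unreduced.\<close>

lemma rotation_funpow:
  assumes "1 \<le> n" "1 \<le> k"
  shows "(rotation a ^^ n) w k = (w k + n) mod a k"
  using assms(1)
proof (induction n rule: nat_induct_at_least)
  case base
  then show ?case using \<open>1 \<le> k\<close> by (simp add: rotation_def)
next
  case (Suc n)
  then show ?case using \<open>1 \<le> k\<close> by (simp add: rotation_def mod_simps)
qed

text \<open>The coordinate is uniform and translation by \<open>n\<close> permutes the residues, so
  exactly one residue is hit.\<close>

lemma prob_hit:
  assumes "1 \<le> k" and a: "\<forall>k\<ge>1. 2 \<le> a k"
  shows "{w \<in> space (Omega_measure a). (w k + n) mod a k = 0} \<in> sets (Omega_measure a)"
    and "measure (Omega_measure a) {w \<in> space (Omega_measure a). (w k + n) mod a k = 0} = 1 / real (a k)"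
proof -
  have ak: "2 \<le> a k" using assms by simp
  let ?U = "uniform_count_measure {0..<a k}" and ?B = "{x \<in> {0..<a k}. (x + n) mod a k = 0}"
  have prob: "prob_space (uniform_count_measure {0..<a i})" if "i \<in> {1..}" for i
    using a that by (intro prob_space_uniform_residues) fastforce
  have k: "k \<in> {1..}" using assms by simp
  have eq: "{w \<in> space (Omega_measure a). (w k + n) mod a k = 0}
      = (\<lambda>w. w k) -` ?B \<inter> space (Omega_measure a)"
    using k by (fastforce simp: Omega_measure_def space_PiM PiE_iff space_uniform_count_measure)
  have comp: "(\<lambda>w. w k) \<in> measurable (Omega_measure a) ?U"
    unfolding Omega_measure_def using k by (rule measurable_component_singleton)
  have B: "?B \<in> sets ?U" by (auto simp add: sets_uniform_count_measure)
  show "{w \<in> space (Omega_measure a). (w k + n) mod a k = 0} \<in> sets (Omega_measure a)"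
    unfolding eq using comp B by (rule measurable_sets)
  have bij: "bij_betw (\<lambda>x. (x + n) mod a k) {0..<a k} {0..<a k}"
    using ak by (intro bij_betw_add_mod) simp
  moreover have "0 \<in> {0..<a k}" using ak by simp
  ultimately obtain x where x: "x \<in> {0..<a k}" "(x + n) mod a k = 0"
    unfolding bij_betw_def by (metis (no_types, lifting) imageE)
  have B_eq: "?B = {x}"
  proof (intro equalityI subsetI)
    fix y assume y: "y \<in> ?B"
    have "y = x"
      by (rule inj_onD[OF bij_betw_imp_inj_on[OF bij]]) (use y x in simp_all)
    then show "y \<in> {x}" by (rule ssubst) simp
  next
    fix y assume "y \<in> {x}"
    then show "y \<in> ?B" using x by simp
  qed
  have "measure ?U ?B = 1 / real (a k)"
    unfolding B_eq using x(1) by (subst measure_uniform_count_measure) simp_all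
  moreover have "measure (Omega_measure a) ((\<lambda>w. w k) -` ?B \<inter> space (Omega_measure a))
      = measure (distr (Omega_measure a) ?U (\<lambda>w. w k)) ?B"
    using comp B by (simp add: measure_distr)
  moreover have "distr (Omega_measure a) ?U (\<lambda>w. w k) = ?U"
    unfolding Omega_measure_def using prob k by (rule distr_PiM_component)
  ultimately show "measure (Omega_measure a) {w \<in> space (Omega_measure a). (w k + n) mod a k = 0}
      = 1 / real (a k)"
    unfolding eq by simp
qed

lemma admissible_sums:
  assumes "admissible a"
  shows "(\<lambda>k. 1 / real (a (Suc k))) sums Sigma_sum a"
proof -
  have "((\<lambda>k. 1 / real (a k)) has_sum Sigma_sum a) {1..}"
    using assms by (simp add: admissible_def Sigma_sum_def del: One_nat_def)
  moreover have "{1..} = range Suc"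
    by (auto simp: image_iff Suc_le_eq gr0_conv_Suc)
  ultimately have "((\<lambda>k. 1 / real (a (Suc k))) has_sum Sigma_sum a) UNIV"
    by (simp add: has_sum_reindex comp_def)
  then show ?thesis by (rule has_sum_imp_sums)
qed

text \<open>Borel-Cantelli: the hit probabilities \<open>1 / a k\<close> are summable. Countability
  of the times \<open>n\<close> gives one null set for all of them.\<close>

lemma AE_finitely_many_hits:
  assumes "admissible a"
  shows "AE w in Omega_measure a. \<forall>n. \<forall>\<^sub>F k in sequentially. (w (Suc k) + n) mod a (Suc k) \<noteq> 0"
  unfolding AE_all_countable
proof
  fix n
  have a: "\<forall>k\<ge>1. 2 \<le> a k" using assms by (simp add: admissible_def)
  interpret prob_space "Omega_measure a" using a by (rule prob_space_Omega_measure)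
  let ?A = "\<lambda>k. {w \<in> space (Omega_measure a). (w (Suc k) + n) mod a (Suc k) = 0}"
  have A: "?A k \<in> sets (Omega_measure a)" "prob (?A k) = 1 / real (a (Suc k))" for k
    using prob_hit[of "Suc k" a n] a by auto
  have "AE w in Omega_measure a. \<forall>\<^sub>F k in sequentially. w \<in> space (Omega_measure a) - ?A k"
  proof (rule borel_cantelli_AE1)
    show "summable (\<lambda>k. prob (?A k))"
      using admissible_sums[OF assms] by (simp only: A(2) sums_iff)
  qed (use A in \<open>auto simp: emeasure_eq_measure\<close>)
  then show "AE w in Omega_measure a. \<forall>\<^sub>F k in sequentially. (w (Suc k) + n) mod a (Suc k) \<noteq> 0"
    by eventually_elim (auto elim: eventually_mono)
qed

text \<open>Only finitely many \<open>k\<close> contribute a sign, so the partial products are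
  eventually constant. Finiteness also puts \<open>Delta\<close> in its \<open>enat\<close> branch,
  where \<open>neg_one_power\<close> is the true sign.\<close>

lemma psi_limit:
  assumes ev: "\<forall>\<^sub>F k in sequentially. (w (Suc k) + n) mod a (Suc k) \<noteq> 0" and "1 \<le> n"
  shows "(\<lambda>K. \<Prod>k = 1..K. if (w k + n) mod a k = 0 then -1 else 1) \<longlonglongrightarrow> real_of_int (psi a w n)"
proof -
  let ?Z = "{k \<in> {1..}. (w k + n) mod a k = 0}"
  obtain L where L: "\<And>k. L \<le> k \<Longrightarrow> (w (Suc k) + n) mod a (Suc k) \<noteq> 0"
    using ev unfolding eventually_sequentially by blast
  have Z: "?Z \<subseteq> {1..L}"
  proof
    fix k assume k: "k \<in> ?Z"
    then have "\<not> L \<le> k - 1" using L[of "k - 1"] by auto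
    then show "k \<in> {1..L}" using k by auto
  qed
  then have fin: "finite ?Z" by (rule finite_subset) simp
  have "{k \<in> {1..}. (rotation a ^^ n) w k = 0} = ?Z"
    using rotation_funpow[OF \<open>1 \<le> n\<close>] by auto
  then have psi: "real_of_int (psi a w n) = (-1) ^ card ?Z"
    using \<open>1 \<le> n\<close> fin by (simp add: psi_def Delta_def neg_one_power_def)
  have "(\<Prod>k = 1..K. if (w k + n) mod a k = 0 then -1 else 1) = (-1 :: real) ^ card ?Z" if "L \<le> K" for K
  proof -
    have "{1..K} \<inter> {k. (w k + n) mod a k = 0} = ?Z"
      using Z that by auto
    then show ?thesis by (simp add: prod.If_cases)
  qed
  then have "\<forall>\<^sub>F K in sequentially.
      (\<Prod>k = 1..K. if (w k + n) mod a k = 0 then -1 else 1) = real_of_int (psi a w n)"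
    unfolding psi eventually_sequentially by blast
  then show ?thesis by (rule tendsto_eventually)
qed

text \<open>For fixed \<open>K\<close> independence factors the mean of the truncated product. Since
  all truncations are bounded by 1, dominated convergence lets \<open>K\<close> tend to
  infinity.\<close>

lemma integral_walsh_nu_limit:
  assumes adm: "admissible a" and S: "finite S" "S \<subseteq> {1..}"
  shows "(\<lambda>K. \<Prod>k = 1..K. walsh_factor S (a k)) \<longlonglongrightarrow> (\<integral>y. walsh S y \<partial>nu a)"
proof -
  have a: "\<forall>k\<ge>1. 2 \<le> a k" using adm by (simp add: admissible_def)
  interpret prob_space "Omega_measure a" using a by (rule prob_space_Omega_measure)
  let ?s = "\<lambda>k n x. if (x + n) mod a k = 0 then -1 else 1 :: real"
  let ?f = "\<lambda>K w. \<Prod>k = 1..K. \<Prod>n\<in>S. ?s k n (w k)"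
  have prob: "prob_space (uniform_count_measure {0..<a k})" if "k \<in> {1..}" for k
    using a that by (intro prob_space_uniform_residues) fastforce
  have psi: "psi a \<in> measurable (Omega_measure a) Y_space"
    using a by (rule psi_measurable)
  have walsh: "walsh S \<in> borel_measurable Y_space"
    using S(2) by (rule walsh_measurable)
  have "(\<lambda>K. integral\<^sup>L (Omega_measure a) (?f K)) \<longlonglongrightarrow> (\<integral>w. walsh S (psi a w) \<partial>Omega_measure a)"
  proof (rule integral_dominated_convergence[where w = "\<lambda>_. 1"])
    show "(\<lambda>w. walsh S (psi a w)) \<in> borel_measurable (Omega_measure a)"
      using psi walsh by (rule measurable_compose)
    show "?f K \<in> borel_measurable (Omega_measure a)" for K
      unfolding Omega_measure_def
      by (intro borel_measurable_prod measurable_PiM_component_rev[where f = "?s _ _"])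
        (auto simp: measurable_def sets_uniform_count_measure space_uniform_count_measure)
    show "AE w in Omega_measure a. (\<lambda>K. ?f K w) \<longlonglongrightarrow> walsh S (psi a w)"
      using AE_finitely_many_hits[OF adm]
    proof eventually_elim
      case (elim w)
      \<comment> \<open>The limit is taken separately for each of the finitely many
        \<open>n\<close>; exchanging the two finite products then recovers
        \<open>?f\<close>.\<close>
      have "(\<lambda>K. \<Prod>n\<in>S. \<Prod>k = 1..K. ?s k n (w k)) \<longlonglongrightarrow> walsh S (psi a w)"
        unfolding walsh_def using S(2) elim by (intro tendsto_prod psi_limit) auto
      then show ?case by (subst prod.swap)
    qed
    show "AE w in Omega_measure a. norm (?f K w) \<le> 1" for K
      by (intro AE_I2) (auto simp: abs_prod intro!: prod_le_1 prod_nonneg)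
  qed simp
  moreover have "integral\<^sup>L (Omega_measure a) (?f K) = (\<Prod>k = 1..K. walsh_factor S (a k))" for K
  proof -
    have "integral\<^sup>L (Omega_measure a) (?f K)
        = (\<Prod>k = 1..K. \<integral>x. (\<Prod>n\<in>S. ?s k n x) \<partial>uniform_count_measure {0..<a k})"
      unfolding Omega_measure_def
      by (rule integral_PiM_finite_prod) (auto simp: prob integrable_uniform_count_measure)
    then show ?thesis by (simp add: integral_uniform_count_measure walsh_factor_def)
  qed
  moreover have "(\<integral>w. walsh S (psi a w) \<partial>Omega_measure a) = (\<integral>y. walsh S y \<partial>nu a)"
    unfolding nu_def using psi walsh by (rule integral_distr[symmetric])
  ultimately show ?thesis by simp
qed

text \<open>The finitely many \<open>k\<close> with \<open>a k < 2 * N\<close> are estimated trivially; they contribute at most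
  \<open>2 * N\<close> to \<open>Sigma_sum a\<close> because pairwise coprime integers \<open>\<ge> 2\<close> are distinct.\<close>

lemma abs_integral_walsh_nu_le:
  assumes adm: "admissible a" and S: "S \<subseteq> {1..N}" "S \<noteq> {}"
  shows "\<bar>\<integral>y. walsh S y \<partial>nu a\<bar> \<le> exp (- 2 * (Sigma_sum a - 2 * real N))"
proof -
  have a: "2 \<le> a k" if "1 \<le> k" for k using adm that by (simp add: admissible_def)
  have inj: "inj_on a {1..}"
  proof (rule inj_onI, rule ccontr)
    fix j k assume jk: "j \<in> {1..}" "k \<in> {1..}" "a j = a k" "j \<noteq> k"
    have "pairwise (\<lambda>j k. coprime (a j) (a k)) {1..}"
      using adm by (simp add: admissible_def)
    then have "coprime (a j) (a k)" using jk(1,2,4) by (rule pairwiseD)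
    then have "a k = 1" using \<open>a j = a k\<close> by simp
    then show False using a[of k] \<open>k \<in> {1..}\<close> by simp
  qed
  have bound: "\<bar>\<Prod>k = 1..K. walsh_factor S (a k)\<bar>
      \<le> exp (- 2 * ((\<Sum>k<K. 1 / real (a (Suc k))) - 2 * real N))" for K
  proof -
    let ?L = "{k \<in> {1..K}. 2 * N \<le> a k}" and ?s = "{k \<in> {1..K}. a k < 2 * N}"
    have "\<bar>\<Prod>k = 1..K. walsh_factor S (a k)\<bar>
        \<le> (\<Prod>k = 1..K. if 2 * N \<le> a k then exp (- 2 / real (a k)) else 1)"
      unfolding abs_prod using abs_walsh_factor_le_exp[OF S] abs_walsh_factor_le
      by (intro prod_mono) auto
    also have "\<dots> = (\<Prod>k\<in>?L. exp (- 2 / real (a k)))"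
      by (rule prod.inter_filter[symmetric]) simp
    also have "\<dots> = exp (- 2 * (\<Sum>k\<in>?L. 1 / real (a k)))"
      by (simp add: exp_sum[symmetric] sum_distrib_left)
    finally have 1: "\<bar>\<Prod>k = 1..K. walsh_factor S (a k)\<bar> \<le> exp (- 2 * (\<Sum>k\<in>?L. 1 / real (a k)))" .
    have "(\<Sum>k\<in>?s. 1 / real (a k)) \<le> (\<Sum>k\<in>?s. 1)"
      using a by (intro sum_mono) (fastforce simp: field_simps)
    also have "\<dots> = real (card (a ` ?s))"
      using inj_on_subset[OF inj, of ?s] by (subst card_image) auto
    also have "\<dots> \<le> real (card {..<2 * N})"
      by (intro of_nat_mono card_mono) auto
    finally have 2: "(\<Sum>k\<in>?s. 1 / real (a k)) \<le> 2 * real N" by simp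
    have "(\<Sum>k<K. 1 / real (a (Suc k))) = (\<Sum>k = 1..K. 1 / real (a k))"
      by (rule sum.reindex_bij_witness[of _ "\<lambda>k. k - 1" Suc]) auto
    also have "\<dots> = (\<Sum>k\<in>?L \<union> ?s. 1 / real (a k))"
      by (intro sum.cong) auto
    also have "\<dots> = (\<Sum>k\<in>?L. 1 / real (a k)) + (\<Sum>k\<in>?s. 1 / real (a k))"
      by (intro sum.union_disjoint) auto
    finally have 3: "(\<Sum>k<K. 1 / real (a (Suc k))) - 2 * real N \<le> (\<Sum>k\<in>?L. 1 / real (a k))"
      using 2 by simp
    show ?thesis
      by (rule order_trans[OF 1]) (use 3 in simp)
  qed
  \<comment> \<open>The bound holds for every \<open>K\<close>, and both of its sides converge, so
    it passes to the limit.\<close>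
  have "(\<lambda>K. exp (- 2 * ((\<Sum>k<K. 1 / real (a (Suc k))) - 2 * real N)))
      \<longlonglongrightarrow> exp (- 2 * (Sigma_sum a - 2 * real N))"
    using admissible_sums[OF adm] unfolding sums_def by (intro tendsto_intros)
  moreover have "(\<lambda>K. \<bar>\<Prod>k = 1..K. walsh_factor S (a k)\<bar>) \<longlonglongrightarrow> \<bar>\<integral>y. walsh S y \<partial>nu a\<bar>"
    using S(1) by (intro tendsto_rabs integral_walsh_nu_limit[OF adm]) (auto intro: finite_subset)
  ultimately show ?thesis
    using bound by (intro LIMSEQ_le[of _ _ "\<lambda>K. exp (- 2 * ((\<Sum>k<K. 1 / real (a (Suc k))) - 2 * real N))"]) auto
qed

section \<open>Comparison of integrals and conclusion\<close>

lemma integrable_Y: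
  fixes g :: "(nat \<Rightarrow> int) \<Rightarrow> real"
  assumes "prob_space M" "sets M = sets Y_space" "g \<in> borel_measurable Y_space"
    and "\<And>y. y \<in> space Y_space \<Longrightarrow> \<bar>g y\<bar> \<le> B"
  shows "integrable M g"
proof -
  interpret prob_space M by fact
  show ?thesis
    using assms(3,4) sets_eq_imp_space_eq[OF assms(2)]
    by (intro integrable_const_bound[where B = B] AE_I2)
      (auto simp: measurable_cong_sets[OF assms(2) refl])
qed

text \<open>The continuous image of a compact space is bounded; this makes \<open>g\<close>
  integrable for both measures.\<close>

lemma continuous_Y_bounded:
  assumes "continuous_map Y_topology euclideanreal g"
  obtains B where "\<And>y. y \<in> space Y_space \<Longrightarrow> \<bar>g y\<bar> \<le> B"
proof -
  have "compactin euclideanreal (g ` topspace Y_topology)"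
    using assms by (intro image_compactin[of Y_topology])
      (auto simp: Y_topology_def compact_space_product_topology compact_space_discrete_topology
        simp flip: compact_space_def topspace_product_topology)
  then have "bounded (g ` topspace Y_topology)"
    by (simp add: compact_imp_bounded)
  then show ?thesis
    using that unfolding bounded_iff topspace_Y_topology space_Y_space by auto
qed

lemma abs_integral_diff_le:
  fixes g p :: "(nat \<Rightarrow> int) \<Rightarrow> real"
  assumes M: "prob_space M" "sets M = sets Y_space"
    and g: "g \<in> borel_measurable Y_space" "\<And>y. y \<in> space Y_space \<Longrightarrow> \<bar>g y\<bar> \<le> B"
    and p: "integrable M p"
    and le: "\<And>y. y \<in> space Y_space \<Longrightarrow> \<bar>g y - p y\<bar> \<le> e"
  shows "\<bar>(\<integral>y. g y \<partial>M) - (\<integral>y. p y \<partial>M)\<bar> \<le> e"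
proof -
  interpret prob_space M by fact
  have int: "integrable M g" using M g by (rule integrable_Y)
  have "\<bar>(\<integral>y. g y \<partial>M) - (\<integral>y. p y \<partial>M)\<bar> = \<bar>\<integral>y. g y - p y \<partial>M\<bar>"
    using int p by simp
  also have "\<dots> \<le> (\<integral>y. \<bar>g y - p y\<bar> \<partial>M)" by (rule integral_abs_bound)
  also have "\<dots> \<le> (\<integral>y. e \<partial>M)"
    using int p le sets_eq_imp_space_eq[OF M(2)] by (intro integral_mono) auto
  finally show ?thesis by (simp add: prob_space)
qed

theorem theorem6p4:
  fixes g :: "(nat \<Rightarrow> int) \<Rightarrow> real" and \<epsilon> :: real
  assumes "continuous_map Y_topology euclideanreal g" and "\<epsilon> > 0"
  shows "\<exists>R>0. \<forall>a::nat \<Rightarrow> nat. admissible a \<and> R < Sigma_sum a \<longrightarrow>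
           \<bar>(\<integral>y. g y \<partial>nu a) - (\<integral>y. g y \<partial>bernoulli_measure)\<bar> < \<epsilon>"
proof -
  obtain N c where Nc: "\<And>y. y \<in> topspace Y_topology \<Longrightarrow>
      \<bar>g y - (\<Sum>S\<in>Pow {1..N}. c S * walsh S y)\<bar> < \<epsilon> / 3"
    by (rule walsh_approximation[OF assms(1), of "\<epsilon> / 3"]) (use \<open>\<epsilon> > 0\<close> in auto)
  let ?P = "Pow {1..N}"
  define p where "p y = (\<Sum>S\<in>?P. c S * walsh S y)" for y
  define C where "C = (\<Sum>S\<in>?P. \<bar>c S\<bar>)"
  have "0 \<le> C" unfolding C_def by (rule sum_nonneg) simp
  \<comment> \<open>Chosen so that \<open>Sigma_sum a > R\<close> forces
    \<open>t = Sigma_sum a - 2 * N\<close> above \<open>3 * C / \<epsilon>\<close>, hence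
    \<open>C / t < \<epsilon> / 3\<close>; the summand 1 keeps \<open>R\<close> positive.\<close>
  define R where "R = 2 * real N + 3 * C / \<epsilon> + 1"
  have walsh_int: "integrable M (walsh S)"
    if "prob_space M" "sets M = sets Y_space" "S \<in> ?P" for M S
  proof -
    have "S \<subseteq> {1..}" using that(3) by auto
    then show ?thesis
      using that(1,2) by (intro integrable_Y[where B = 1] walsh_measurable) (auto simp: abs_walsh)
  qed
  have p_integral: "integrable M p" "(\<integral>y. p y \<partial>M) = (\<Sum>S\<in>?P. c S * (\<integral>y. walsh S y \<partial>M))"
    if "prob_space M" "sets M = sets Y_space" for M
    unfolding p_def using walsh_int[OF that] by auto
  obtain B where B: "\<And>y. y \<in> space Y_space \<Longrightarrow> \<bar>g y\<bar> \<le> B"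
    using continuous_Y_bounded[OF assms(1)] by blast
  have approx: "\<bar>(\<integral>y. g y \<partial>M) - (\<integral>y. p y \<partial>M)\<bar> \<le> \<epsilon> / 3"
    if "prob_space M" "sets M = sets Y_space" for M
    using that continuous_Y_measurable[OF assms(1)] B p_integral(1)[OF that]
  proof (rule abs_integral_diff_le)
    show "\<bar>g y - p y\<bar> \<le> \<epsilon> / 3" if "y \<in> space Y_space" for y
      using Nc[of y] that unfolding p_def topspace_Y_topology space_Y_space by linarith
  qed
  have "\<bar>(\<integral>y. g y \<partial>nu a) - (\<integral>y. g y \<partial>bernoulli_measure)\<bar> < \<epsilon>"
    if adm: "admissible a" and R: "R < Sigma_sum a" for a
  proof -
    note nu = prob_space_nu[OF adm] sets_nu[of a]
    note bernoulli = prob_space_bernoulli_measure sets_bernoulli_measure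
    define t where "t = Sigma_sum a - 2 * real N"
    have "0 \<le> 3 * C / \<epsilon>" using \<open>0 \<le> C\<close> \<open>\<epsilon> > 0\<close> by simp
    then have t: "3 * C / \<epsilon> < t" "0 < t"
      using R unfolding R_def t_def by linarith+
    \<comment> \<open>For empty \<open>S\<close> the Walsh function is constantly 1 and the
      integrals coincide; otherwise the Bernoulli integral vanishes and the decay estimate for
      \<open>nu a\<close> applies.\<close>
    have walsh_diff: "\<bar>(\<integral>y. walsh S y \<partial>nu a) - (\<integral>y. walsh S y \<partial>bernoulli_measure)\<bar> \<le> exp (- 2 * t)"
      if S: "S \<in> ?P" for S
    proof (cases "S = {}")
      case True
      then have "(\<integral>y. walsh S y \<partial>nu a) = 1" "(\<integral>y. walsh S y \<partial>bernoulli_measure) = 1"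
        by (simp_all add: walsh_def prob_space.prob_space[OF nu(1)] prob_space.prob_space[OF bernoulli(1)])
      then show ?thesis by simp
    next
      case False
      then have "(\<integral>y. walsh S y \<partial>bernoulli_measure) = 0"
        using S by (intro integral_walsh_bernoulli) (auto intro: finite_subset)
      then show ?thesis
        using abs_integral_walsh_nu_le[OF adm _ False] S by (simp add: t_def)
    qed
    have "\<bar>(\<integral>y. p y \<partial>nu a) - (\<integral>y. p y \<partial>bernoulli_measure)\<bar>
        = \<bar>\<Sum>S\<in>?P. c S * ((\<integral>y. walsh S y \<partial>nu a) - (\<integral>y. walsh S y \<partial>bernoulli_measure))\<bar>"
      by (simp add: p_integral[OF nu] p_integral[OF bernoulli] right_diff_distrib sum_subtractf)
    also have "\<dots> \<le> (\<Sum>S\<in>?P. \<bar>c S\<bar> * exp (- 2 * t))"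
      using walsh_diff by (intro order_trans[OF sum_abs] sum_mono) (auto simp: abs_mult intro: mult_left_mono)
    also have "\<dots> = C * exp (- 2 * t)" by (simp add: C_def sum_distrib_right)
    \<comment> \<open>Weakening the exponential to \<open>1 / t\<close>, through
      \<open>t \<le> 1 + 2 * t \<le> exp (2 * t)\<close>, permits a threshold \<open>R\<close>
      without logarithms.\<close>
    also have "\<dots> \<le> C / t"
    proof -
      have "t \<le> exp (2 * t)" using exp_ge_add_one_self[of "2 * t"] t(2) by linarith
      then have "exp (- 2 * t) \<le> 1 / t" using t(2) by (simp add: exp_minus field_simps)
      then show ?thesis using \<open>0 \<le> C\<close> mult_left_mono[of _ _ C] by fastforce
    qed
    also have "\<dots> < \<epsilon> / 3"
      using t \<open>\<epsilon> > 0\<close> by (simp add: field_simps)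
    \<comment> \<open>Replacing \<open>g\<close> by \<open>p\<close> costs at most a third of
      \<open>\<epsilon>\<close> under each measure; the remaining third is the strict bound for
      \<open>p\<close>.\<close>
    finally show ?thesis
      using approx[OF nu] approx[OF bernoulli] by linarith
  qed
  moreover have "R > 0" using \<open>0 \<le> C\<close> \<open>\<epsilon> > 0\<close> by (simp add: R_def add_nonneg_pos)
  ultimately show ?thesis by blast
qed

end
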